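(* Consider the Cournot model with linear inverse demand and fixed period-1 capacity $K>0$ described in the context, with $\eta^P=\eta(2K)$, $\eta^F=\eta(K)$, and assume $0<b<a/(3K\eta^P)$ (so that the period-2 irreversibility constraint is slack at the symmetric Cournot equilibrium in both regimes). (a) In the limit $c_2\to\infty$ (no period-2 expansion), pooling is sustainable, i.e. $\delta\lim_{c_2\to\infty}\bigl[v_2(\eta^P,K)-v_2(\eta^F,K)\bigr]>0$, if and only if $$b\;<\;b^\star(K):=\frac{a}{2K(\eta^P+\eta^F)}.$$ (b) For finite $c_2>0$, the map $b\mapsto U^P(b)-U^F(b)=\delta[v_2(\eta^P,K)-v_2(\eta^F,K)]$ is strictly positive as $b\to0^+$ (its limit as $b\to 0^+$ is strictly positive), and is strictly decreasing in $b$ at $b=0$ (its derivative in $b$ at $b=0$, computed with the same formulas extended to $b=0$, is strictly negative). Its sign away from $b=0$ is governed by the monotonicity of $v_2(\cdot,K)$ in $\eta$ (it is positive if $v_2(\cdot,K)$ is strictly increasing on $[\eta^F,\eta^P]$ and negative if $v_2(\cdot,K)$ is strictly decreasing there), and for every $\eta>0$ with $a>3b\eta K$ one has the decomposition $$\frac{\partial v_2}{\partial\eta}(\eta,K)=K_2^*\bigl(a-4b\eta K_2^*\bigr)-b\,\eta^2K_2^*\,\frac{\partial K_2^*}{\partial\eta},\qquad K_2^*=K_2^*(\eta,K).$$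
   Context: Parameters: $a>0$, $b>0$ (inverse demand $P(Q)=a-bQ$ in each period), $c_2>0$ (period-2 expansion cost coefficient), $\delta\in(0,1]$ (discount factor). The learning curve $\eta:[0,\infty)\to[0,\infty)$ is twice continuously differentiable, strictly increasing, strictly concave and bounded. Two symmetric firms each have the same predetermined period-1 capacity $K>0$. In period 2 both have productivity $\eta^P=\eta(2K)$ if data are pooled and $\eta^F=\eta(K)$ if fragmented. Given a common productivity $\eta>0$, the firms simultaneously choose $K_{i,2}\ge K$, firm $i$ earning $[a-b\eta(K_{1,2}+K_{2,2})]K_{i,2}\eta-\frac{c_2}{2}(K_{i,2}-K)^2$. The symmetric Cournot equilibrium capacity when $a>3b\eta K$ is $$K_2^*(\eta,K)=\frac{a\eta+c_2K}{3b\eta^2+c_2},$$ and the reduced period-2 value is $$v_2(\eta,K):=K_2^*(\eta,K)\,\eta\,\bigl[a-2b\eta K_2^*(\eta,K)\bigr]-\tfrac{c_2}{2}\bigl[K_2^*(\eta,K)-K\bigr]^2 .$$ (The dependence on $a,b,c_2$ is suppressed; $b=0$ is allowed in these formulas.) Since period-1 payoffs are identical in the two regimes, the difference between a firm's pooled and fragmented payoffs is $U^P-U^F=\delta[v_2(\eta^P,K)-v_2(\eta^F,K)]$. Pooling is called sustainable when $U^P>U^F$; in the limit $c_2\to\infty$ this means that the limiting difference is strictly positive. *)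

theory Defs
  imports "HOL-Analysis.Analysis"
begin

text \<open>The domain is \<open>[0, \<infinity>)\<close>; derivatives at the endpoint 0 are one-sided,
  and nothing is assumed about negative arguments.\<close>

definition twice_cont_diff_nonneg :: "(real \<Rightarrow> real) \<Rightarrow> bool" where
  "twice_cont_diff_nonneg f \<longleftrightarrow>
     (\<exists>f' f''. (\<forall>x\<ge>0. (f has_real_derivative f' x) (at x within {0..})) \<and>
               (\<forall>x\<ge>0. (f' has_real_derivative f'' x) (at x within {0..})) \<and>
               continuous_on {0..} f'')"

definition strictly_concave_on :: "real set \<Rightarrow> (real \<Rightarrow> real) \<Rightarrow> bool" where
  "strictly_concave_on S f \<longleftrightarrow> convex S \<and>
     (\<forall>x\<in>S. \<forall>y\<in>S. \<forall>t. x \<noteq> y \<and> 0 < t \<and> t < 1 \<longrightarrow>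
        (1 - t) * f x + t * f y < f ((1 - t) * x + t * y))"

definition learning_curve :: "(real \<Rightarrow> real) \<Rightarrow> bool" where
  "learning_curve \<eta> \<longleftrightarrow>
     (\<forall>x\<ge>0. 0 \<le> \<eta> x) \<and>
     twice_cont_diff_nonneg \<eta> \<and>
     strict_mono_on {0..} \<eta> \<and>
     strictly_concave_on {0..} \<eta> \<and>
     bounded (\<eta> ` {0..})"

text \<open>Period-2 profit of a firm choosing capacity \<open>x\<close> against a rival choosing \<open>y\<close>,
  both with productivity \<open>h\<close> and inherited capacity \<open>K\<close>.\<close>

definition period2_profit :: "real \<Rightarrow> real \<Rightarrow> real \<Rightarrow> real \<Rightarrow> real \<Rightarrow> real \<Rightarrow> real \<Rightarrow> real" where
  "period2_profit a b c\<^sub>2 h K x y =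
     (a - b * h * (x + y)) * x * h - c\<^sub>2 / 2 * (x - K)\<^sup>2"

definition symmetric_cournot_equilibrium :: "real \<Rightarrow> real \<Rightarrow> real \<Rightarrow> real \<Rightarrow> real \<Rightarrow> real \<Rightarrow> bool" where
  "symmetric_cournot_equilibrium a b c\<^sub>2 h K x \<longleftrightarrow>
     x \<ge> K \<and> (\<forall>x'\<ge>K. period2_profit a b c\<^sub>2 h K x' x \<le> period2_profit a b c\<^sub>2 h K x x)"

definition K2_star :: "real \<Rightarrow> real \<Rightarrow> real \<Rightarrow> real \<Rightarrow> real \<Rightarrow> real" where
  "K2_star a b c\<^sub>2 h K = (a * h + c\<^sub>2 * K) / (3 * b * h\<^sup>2 + c\<^sub>2)"

definition v2 :: "real \<Rightarrow> real \<Rightarrow> real \<Rightarrow> real \<Rightarrow> real \<Rightarrow> real" where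
  "v2 a b c\<^sub>2 h K =
     K2_star a b c\<^sub>2 h K * h * (a - 2 * b * h * K2_star a b c\<^sub>2 h K)
       - c\<^sub>2 / 2 * (K2_star a b c\<^sub>2 h K - K)\<^sup>2"

text \<open>\<open>U\<^sup>P - U\<^sup>F\<close>: the period-1 payoffs coincide in the two regimes and cancel.\<close>

definition pooling_gain :: "real \<Rightarrow> real \<Rightarrow> real \<Rightarrow> real \<Rightarrow> (real \<Rightarrow> real) \<Rightarrow> real \<Rightarrow> real" where
  "pooling_gain \<delta> a b c\<^sub>2 \<eta> K = \<delta> * (v2 a b c\<^sub>2 (\<eta> (2 * K)) K - v2 a b c\<^sub>2 (\<eta> K) K)"

text \<open>The closed forms \<^const>\<open>K2_star\<close> and \<^const>\<open>v2\<close> are the symmetric equilibrium capacity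
  and the profit earned there.\<close>

lemma v2_eq_period2_profit:
  "v2 a b c\<^sub>2 h K = period2_profit a b c\<^sub>2 h K (K2_star a b c\<^sub>2 h K) (K2_star a b c\<^sub>2 h K)"
  by (simp add: v2_def period2_profit_def algebra_simps)

lemma symmetric_cournot_equilibrium_K2_star:
  assumes "b > 0" "c\<^sub>2 > 0" "h > 0" "a > 3 * b * h * K"
  shows "symmetric_cournot_equilibrium a b c\<^sub>2 h K (K2_star a b c\<^sub>2 h K)"
    and "K2_star a b c\<^sub>2 h K > K"
proof -
  define x where "x = K2_star a b c\<^sub>2 h K"
  have den: "3 * b * h\<^sup>2 + c\<^sub>2 > 0"
    using assms by (simp add: add_pos_pos)
  have foc: "a * h + c\<^sub>2 * K = x * (3 * b * h\<^sup>2 + c\<^sub>2)"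
    using den by (simp add: x_def K2_star_def)
  have "3 * b * h * K * h < a * h"
    using assms by (intro mult_strict_right_mono) auto
  hence "K * (3 * b * h\<^sup>2 + c\<^sub>2) < x * (3 * b * h\<^sup>2 + c\<^sub>2)"
    unfolding foc[symmetric] by (simp add: algebra_simps power2_eq_square)
  hence gt: "x > K"
    using den by (simp add: mult_less_cancel_right)
  have "period2_profit a b c\<^sub>2 h K x' x \<le> period2_profit a b c\<^sub>2 h K x x" for x'
  proof -
    have "period2_profit a b c\<^sub>2 h K x x - period2_profit a b c\<^sub>2 h K x' x
        = (x - x') * (a * h + c\<^sub>2 * K - x * (3 * b * h\<^sup>2 + c\<^sub>2)) + (b * h\<^sup>2 + c\<^sub>2 / 2) * (x - x')\<^sup>2"
      by (simp add: period2_profit_def field_simps power2_eq_square)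
    also have "\<dots> = (b * h\<^sup>2 + c\<^sub>2 / 2) * (x - x')\<^sup>2"
      by (simp add: foc)
    also have "\<dots> \<ge> 0"
      using assms by (intro mult_nonneg_nonneg) auto
    finally show ?thesis by simp
  qed
  with gt show "symmetric_cournot_equilibrium a b c\<^sub>2 h K (K2_star a b c\<^sub>2 h K)"
    and "K2_star a b c\<^sub>2 h K > K"
    by (auto simp: symmetric_cournot_equilibrium_def x_def)
qed

end

theory Submission
  imports Defs "HOL-Real_Asymp.Real_Asymp"
begin

text \<open>The first-order condition \<open>c\<^sub>2 (K\<^sub>2\<^sup>* - K) = h (a - 3 b h K\<^sub>2\<^sup>*)\<close> drives every part.
  Differentiating \<open>v\<^sub>2\<close>, it collapses the coefficient of the derivative of \<open>K\<^sub>2\<^sup>*\<close> to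
  \<open>- b h\<^sup>2 K\<^sub>2\<^sup>*\<close>. That term vanishes at \<open>b = 0\<close>, where \<open>v\<^sub>2\<close> equals
  \<open>a h K + a\<^sup>2 h\<^sup>2 / (2 c\<^sub>2)\<close> and has \<open>b\<close>-derivative \<open>- 2 (h K\<^sub>2\<^sup>*)\<^sup>2\<close>; the first is increasing
  and the second decreasing in \<open>h\<close>. As \<open>c\<^sub>2 \<rightarrow> \<infinity>\<close>, the condition bounds \<open>c\<^sub>2 (K\<^sub>2\<^sup>* - K)\<close>, so
  the expansion cost vanishes and \<open>v\<^sub>2 \<rightarrow> K h (a - 2 b h K)\<close>.\<close>

lemma learning_curve_pos:
  assumes "learning_curve \<eta>" "x > 0"
  shows "\<eta> x > 0"
proof -
  have "0 \<le> \<eta> 0" "\<eta> 0 < \<eta> x"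
    using assms by (auto simp: learning_curve_def strict_mono_on_def)
  thus ?thesis by simp
qed

lemma zero_less_mult_pos_iff: "x > 0 \<Longrightarrow> x * y > 0 \<longleftrightarrow> y > 0" for x y :: real
  by (simp add: zero_less_mult_iff)

text \<open>Clearing the denominator of the closed form balances marginal expansion cost against
  marginal revenue. Only a nonzero denominator is assumed, so the same identity serves at
  \<open>b = 0\<close> and for all large \<open>c\<close>.\<close>

lemma K2_star_first_order_condition:
  assumes "3 * b * h\<^sup>2 + c \<noteq> 0"
  shows "c * (K2_star a b c h K - K) = h * (a - 3 * b * h * K2_star a b c h K)"
proof -
  have "K2_star a b c h K * (3 * b * h\<^sup>2 + c) = a * h + c * K"
    using assms by (simp add: K2_star_def)
  thus ?thesis by (simp add: algebra_simps power2_eq_square)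
qed

lemma K2_star_tendsto: "((\<lambda>c. K2_star a b c h K) \<longlongrightarrow> K) at_top"
  unfolding K2_star_def by real_asymp

lemma v2_tendsto: "((\<lambda>c. v2 a b c h K) \<longlongrightarrow> K * h * (a - 2 * b * h * K)) at_top"
proof -
  let ?k = "\<lambda>c. K2_star a b c h K"
  \<comment> \<open>The expansion cost pairs the unbounded factor \<open>c\<close> with a vanishing
    square. Trading \<open>c * (?k c - K)\<close> for its first-order value leaves an expression
    that depends on \<open>c\<close> only through \<open>?k c\<close>, so
    \<open>K2_star_tendsto\<close> suffices.\<close>
  have "((\<lambda>c. ?k c * h * (a - 2 * b * h * ?k c) - h * (a - 3 * b * h * ?k c) * (?k c - K) / 2)
        \<longlongrightarrow> K * h * (a - 2 * b * h * K) - h * (a - 3 * b * h * K) * (K - K) / 2) at_top"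
    by (intro tendsto_intros K2_star_tendsto) auto
  moreover have "\<forall>\<^sub>F c in at_top. ?k c * h * (a - 2 * b * h * ?k c)
      - h * (a - 3 * b * h * ?k c) * (?k c - K) / 2 = v2 a b c h K"
    \<comment> \<open>Beyond this threshold the denominator of \<open>K2_star\<close> is positive,
      whatever the sign of \<open>b\<close>.\<close>
    using eventually_gt_at_top[of "- (3 * b * h\<^sup>2)"]
  proof eventually_elim
    case (elim c)
    hence "3 * b * h\<^sup>2 + c \<noteq> 0" by linarith
    from K2_star_first_order_condition[OF this, of a K, symmetric]
    show ?case by (simp add: v2_def power2_eq_square)
  qed
  ultimately have "((\<lambda>c. v2 a b c h K) \<longlongrightarrow>
      K * h * (a - 2 * b * h * K) - h * (a - 3 * b * h * K) * (K - K) / 2) at_top"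
    by (rule Lim_transform_eventually)
  thus ?thesis by simp
qed

lemma v2_zero_slope:
  assumes "c > 0"
  shows "v2 a 0 c h K = a * h * K + a\<^sup>2 * h\<^sup>2 / (2 * c)"
  using assms by (simp add: v2_def K2_star_def field_simps power2_eq_square)

text \<open>An envelope argument: with zero slope the rival does not affect the price, so the chosen
  capacity makes \<open>v2\<close> stationary. The terms in \<open>k'\<close> cancel and only the
  direct effect of the slope on revenue survives.\<close>

lemma v2_has_derivative_slope:
  assumes "c > 0"
  shows "((\<lambda>\<beta>. v2 a \<beta> c h K) has_real_derivative - 2 * (h * K2_star a 0 c h K)\<^sup>2) (at 0)"
proof -
  define k where "k = K2_star a 0 c h K"
  define k' where "k' = - 3 * h\<^sup>2 * (a * h + c * K) / c\<^sup>2"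
  have dk: "((\<lambda>\<beta>. K2_star a \<beta> c h K) has_real_derivative k') (at 0)"
    unfolding K2_star_def using assms
    by (auto intro!: derivative_eq_intros simp: k'_def field_simps power2_eq_square)
  have foc: "c * (k - K) = h * a"
    using K2_star_first_order_condition[of 0 h c a K] assms by (simp add: k_def)
  have "((\<lambda>\<beta>. v2 a \<beta> c h K) has_real_derivative
      k' * h * a - 2 * h\<^sup>2 * k\<^sup>2 - c * (k - K) * k') (at 0)"
    unfolding v2_def
    by (auto intro!: derivative_eq_intros dk simp: k_def[symmetric] algebra_simps power2_eq_square)
  moreover have "k' * h * a - 2 * h\<^sup>2 * k\<^sup>2 - c * (k - K) * k' = - 2 * (h * k)\<^sup>2"
    unfolding foc by (simp add: power_mult_distrib)
  ultimately show ?thesis by (simp only: k_def)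
qed

text \<open>When both capacities move with productivity, the effect through a firm's own choice
  vanishes by the first-order condition. What remains is the revenue lost to the rival's expansion,
  \<open>- b * h\<^sup>2 * k\<close> per unit.\<close>

lemma v2_has_derivative_productivity:
  assumes dk: "((\<lambda>x. K2_star a b c x K) has_real_derivative k') (at h)"
    and nz: "3 * b * h\<^sup>2 + c \<noteq> 0"
  defines "k \<equiv> K2_star a b c h K"
  shows "((\<lambda>x. v2 a b c x K) has_real_derivative
      k * (a - 4 * b * h * k) - b * h\<^sup>2 * k * k') (at h)"
proof -
  have foc: "c * (k - K) = h * (a - 3 * b * h * k)"
    unfolding k_def by (rule K2_star_first_order_condition[OF nz])
  have "((\<lambda>x. v2 a b c x K) has_real_derivative
      k * (a - 4 * b * h * k) + (h * a - 4 * b * h\<^sup>2 * k - c * (k - K)) * k') (at h)"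
    unfolding v2_def
    by (auto intro!: derivative_eq_intros dk simp: k_def[symmetric] algebra_simps power2_eq_square)
  moreover have "k * (a - 4 * b * h * k) + (h * a - 4 * b * h\<^sup>2 * k - c * (k - K)) * k'
      = k * (a - 4 * b * h * k) - b * h\<^sup>2 * k * k'"
    unfolding foc by (simp add: algebra_simps power2_eq_square)
  ultimately show ?thesis by (simp only:)
qed

theorem proposition5:
  fixes a b c\<^sub>2 \<delta> K \<eta>P \<eta>F :: real and \<eta> :: "real \<Rightarrow> real"
  assumes "a > 0" and "K > 0" and "c\<^sub>2 > 0" and "0 < \<delta>" and "\<delta> \<le> 1"
    and "learning_curve \<eta>"
    and "\<eta>P = \<eta> (2 * K)" and "\<eta>F = \<eta> K"
    and "0 < b" and "b < a / (3 * K * \<eta>P)"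
  shows
    "(\<exists>L. ((\<lambda>c. v2 a b c \<eta>P K - v2 a b c \<eta>F K) \<longlongrightarrow> L) at_top \<and>
          (\<delta> * L > 0 \<longleftrightarrow> b < a / (2 * K * (\<eta>P + \<eta>F)))) \<and>
     (\<exists>L>0. ((\<lambda>\<beta>. pooling_gain \<delta> a \<beta> c\<^sub>2 \<eta> K) \<longlongrightarrow> L) (at_right 0)) \<and>
     (\<exists>D<0. ((\<lambda>\<beta>. pooling_gain \<delta> a \<beta> c\<^sub>2 \<eta> K) has_real_derivative D) (at 0)) \<and>
     (strict_mono_on {\<eta>F..\<eta>P} (\<lambda>h. v2 a b c\<^sub>2 h K) \<longrightarrow> pooling_gain \<delta> a b c\<^sub>2 \<eta> K > 0) \<and>
     (strict_antimono_on {\<eta>F..\<eta>P} (\<lambda>h. v2 a b c\<^sub>2 h K) \<longrightarrow> pooling_gain \<delta> a b c\<^sub>2 \<eta> K < 0) \<and>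
     (\<forall>h>0. a > 3 * b * h * K \<longrightarrow>
        (\<exists>K2'. ((\<lambda>x. K2_star a b c\<^sub>2 x K) has_real_derivative K2') (at h) \<and>
           ((\<lambda>x. v2 a b c\<^sub>2 x K) has_real_derivative
              (K2_star a b c\<^sub>2 h K * (a - 4 * b * h * K2_star a b c\<^sub>2 h K)
                - b * h\<^sup>2 * K2_star a b c\<^sub>2 h K * K2')) (at h)))"
proof (intro conjI)
  have F: "\<eta>F > 0" and FP: "\<eta>F < \<eta>P"
    using assms learning_curve_pos[of \<eta> K]
    by (auto simp: learning_curve_def strict_mono_on_def)
  hence P: "\<eta>P > 0" by simp
  let ?d = "\<lambda>\<beta>. v2 a \<beta> c\<^sub>2 \<eta>P K - v2 a \<beta> c\<^sub>2 \<eta>F K"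
  have gain: "pooling_gain \<delta> a \<beta> c\<^sub>2 \<eta> K = \<delta> * ?d \<beta>" for \<beta>
    using assms by (simp add: pooling_gain_def)

  show "\<exists>L. ((\<lambda>c. v2 a b c \<eta>P K - v2 a b c \<eta>F K) \<longlongrightarrow> L) at_top \<and>
      (\<delta> * L > 0 \<longleftrightarrow> b < a / (2 * K * (\<eta>P + \<eta>F)))"
  proof (intro exI conjI)
    let ?L = "K * \<eta>P * (a - 2 * b * \<eta>P * K) - K * \<eta>F * (a - 2 * b * \<eta>F * K)"
    show "((\<lambda>c. v2 a b c \<eta>P K - v2 a b c \<eta>F K) \<longlongrightarrow> ?L) at_top"
      by (intro tendsto_diff v2_tendsto)
    have "\<delta> * ?L = \<delta> * K * (\<eta>P - \<eta>F) * (a - b * (2 * K * (\<eta>P + \<eta>F)))"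
      by (simp add: algebra_simps)
    moreover have "\<delta> * K * (\<eta>P - \<eta>F) > 0"
      using assms FP by simp
    ultimately have "\<delta> * ?L > 0 \<longleftrightarrow> b * (2 * K * (\<eta>P + \<eta>F)) < a"
      by (simp only: zero_less_mult_pos_iff diff_gt_0_iff_gt)
    also have "\<dots> \<longleftrightarrow> b < a / (2 * K * (\<eta>P + \<eta>F))"
      using \<open>K > 0\<close> F P by (simp add: pos_less_divide_eq)
    finally show "\<delta> * ?L > 0 \<longleftrightarrow> b < a / (2 * K * (\<eta>P + \<eta>F))" .
  qed

  let ?k = "\<lambda>h. K2_star a 0 c\<^sub>2 h K"
  let ?D = "\<delta> * (- 2 * (\<eta>P * ?k \<eta>P)\<^sup>2 - - 2 * (\<eta>F * ?k \<eta>F)\<^sup>2)"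
  have deriv: "((\<lambda>\<beta>. pooling_gain \<delta> a \<beta> c\<^sub>2 \<eta> K) has_real_derivative ?D) (at 0)"
    unfolding gain using \<open>c\<^sub>2 > 0\<close>
    by (intro DERIV_cmult DERIV_diff v2_has_derivative_slope)
  have "?k \<eta>F > 0" "?k \<eta>F \<le> ?k \<eta>P"
    using assms(1-3) F FP by (auto simp: K2_star_def field_simps intro!: add_pos_pos)
  hence "0 < \<eta>F * ?k \<eta>F" "\<eta>F * ?k \<eta>F < \<eta>P * ?k \<eta>P"
    using F FP by (auto intro: mult_less_le_imp_less)
  hence "(\<eta>F * ?k \<eta>F)\<^sup>2 < (\<eta>P * ?k \<eta>P)\<^sup>2"
    by (intro power_strict_mono) auto
  hence "?D < 0"
    using \<open>\<delta> > 0\<close> by (intro mult_pos_neg) auto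
  with deriv show "\<exists>D<0. ((\<lambda>\<beta>. pooling_gain \<delta> a \<beta> c\<^sub>2 \<eta> K) has_real_derivative D) (at 0)"
    by blast

  have "a * \<eta>F * K < a * \<eta>P * K"
    using assms(1,2) FP by simp
  moreover have "a\<^sup>2 * \<eta>F\<^sup>2 / (2 * c\<^sub>2) \<le> a\<^sup>2 * \<eta>P\<^sup>2 / (2 * c\<^sub>2)"
    using assms(3) F FP by (intro divide_right_mono mult_left_mono power_mono) auto
  ultimately have "?d 0 > 0"
    by (simp add: v2_zero_slope[OF \<open>c\<^sub>2 > 0\<close>])
  hence "pooling_gain \<delta> a 0 c\<^sub>2 \<eta> K > 0"
    using \<open>\<delta> > 0\<close> by (simp add: gain)
  moreover have "((\<lambda>\<beta>. pooling_gain \<delta> a \<beta> c\<^sub>2 \<eta> K) \<longlongrightarrow> pooling_gain \<delta> a 0 c\<^sub>2 \<eta> K) (at_right 0)"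
    using DERIV_isCont[OF deriv] by (auto simp: isCont_def intro: tendsto_within_subset)
  ultimately show "\<exists>L>0. ((\<lambda>\<beta>. pooling_gain \<delta> a \<beta> c\<^sub>2 \<eta> K) \<longlongrightarrow> L) (at_right 0)"
    by blast

  show "strict_mono_on {\<eta>F..\<eta>P} (\<lambda>h. v2 a b c\<^sub>2 h K) \<longrightarrow> pooling_gain \<delta> a b c\<^sub>2 \<eta> K > 0"
    using FP \<open>\<delta> > 0\<close> by (auto simp: gain monotone_on_def)
  show "strict_antimono_on {\<eta>F..\<eta>P} (\<lambda>h. v2 a b c\<^sub>2 h K) \<longrightarrow> pooling_gain \<delta> a b c\<^sub>2 \<eta> K < 0"
    using FP \<open>\<delta> > 0\<close> by (auto simp: gain monotone_on_def intro!: mult_pos_neg)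

  show "\<forall>h>0. a > 3 * b * h * K \<longrightarrow>
      (\<exists>K2'. ((\<lambda>x. K2_star a b c\<^sub>2 x K) has_real_derivative K2') (at h) \<and>
         ((\<lambda>x. v2 a b c\<^sub>2 x K) has_real_derivative
            (K2_star a b c\<^sub>2 h K * (a - 4 * b * h * K2_star a b c\<^sub>2 h K)
              - b * h\<^sup>2 * K2_star a b c\<^sub>2 h K * K2')) (at h))"
  proof (intro allI impI)
    fix h :: real
    have nz: "3 * b * h\<^sup>2 + c\<^sub>2 \<noteq> 0"
      using \<open>b > 0\<close> \<open>c\<^sub>2 > 0\<close> by (simp add: add_nonneg_pos less_imp_neq[symmetric])
    have "(\<lambda>x. K2_star a b c\<^sub>2 x K) differentiable (at h)"
      unfolding K2_star_def using nz by (intro derivative_intros) auto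
    then obtain k' where "((\<lambda>x. K2_star a b c\<^sub>2 x K) has_real_derivative k') (at h)"
      by (auto simp: real_differentiable_def)
    with v2_has_derivative_productivity[OF this nz]
    show "\<exists>K2'. ((\<lambda>x. K2_star a b c\<^sub>2 x K) has_real_derivative K2') (at h) \<and>
         ((\<lambda>x. v2 a b c\<^sub>2 x K) has_real_derivative
            (K2_star a b c\<^sub>2 h K * (a - 4 * b * h * K2_star a b c\<^sub>2 h K)
              - b * h\<^sup>2 * K2_star a b c\<^sub>2 h K * K2')) (at h)"
      by blast
  qed
qed

end
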